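(* Let $X$ be a finite simplicial complex, $f:X\to X$ an index-strict map and $h:X\to\mathbb{R}$ a real $f$-integrable map. Then the limits $$\lim_{n\to\infty}\frac{1}{2^n}\int_X\lfloor 2^n h\rfloor\;d\,i_c(f)\qquad\text{and}\qquad \lim_{n\to\infty}\frac{1}{2^n}\int_X\lceil 2^n h\rceil\;d\,i_c(f)$$ exist.
   Context: Simplicial complexes are finite and identified with their geometric realizations. $\overline{A}$ and $\mathring{A}$ denote the closure and interior of $A$ in $X$; $\mathds{1}_A$ is the characteristic function; $\lfloor\cdot\rfloor$ and $\lceil\cdot\rceil$ are the floor and ceiling functions. Fixed point index: for a compact polyhedron $X$, a continuous map $f:X\to X$ and an open set $U\subset X$ such that $f$ has no fixed points in $\overline{U}\setminus U$, $i(X,f,U)\in\mathbb{Z}$ is the classical fixed point index. Concretely: embed $X$ in some $\mathbb{R}^n$, choose a retraction $r:W\to X$ of an open neighbourhood $W$ of $X$; then $i(X,f,U)$ is the local degree over $0$ of $x\mapsto x-f(r(x))$ on the open set $r^{-1}(U)\subset\mathbb{R}^n$; it does not depend on the choices. Combinatorial fixed point index: for $f:X\to X$ continuous and any $A\subset X$ such that $f$ has no fixed points in $\overline{A}\setminus\mathring{A}$, $i_c(X,f,A):=i(X,f,\mathring{A})$. Integral: if $k=\sum_{j=1}^n d_j\mathds{1}_{U_j}:X\to\mathbb{Z}$ with $d_j\in\mathbb{Z}$ and $f$ without fixed points in $\overline{U_j}\setminus\mathring{U_j}$ for every $j$, then $\int_X k\;d\,i_c(f):=\sum_{j=1}^n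 d_j\, i_c(X,f,U_j)$ (independent of the expression chosen for $k$). A continuous map $f:X\to X$ is index-strict if either $i(X,f,U)\ge 0$ for all open $U\subset X$ such that $f$ has no fixed points in $\overline{U}\setminus U$, or $i(X,f,U)\le 0$ for all such $U$. For $f$ index-strict, a (not necessarily continuous) map $h:X\to\mathbb{R}$ is real $f$-integrable if: (i) for every rational $p$, $f$ has no fixed points in $\overline{h^{-1}(p)}$; (ii) for all rationals $p<q$, $f$ has no fixed points in $\overline{h^{-1}((p,q))}$ minus the interior of $h^{-1}((p,q))$; (iii) $h$ is bounded. *)

theory Defs
  imports "HOL-Analysis.Analysis" "HOL-Homology.Homology"
begin

text \<open>Local degree over \<open>0\<close> of a continuous map \<open>g\<close>, defined on an open set \<open>V\<close> of a Euclidean space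
  of dimension \<open>n\<close>, whose zero set \<open>K\<close> in \<open>V\<close> is compact. Write \<open>E\<close> for the space and \<open>B\<close> for
  a closed ball about the origin that contains \<open>K\<close>. The degree is the integer \<open>d\<close> such that a class
  of \<open>H\<^sub>n(E, E - B)\<close>, restricted to \<open>H\<^sub>n(E, E - K)\<close>, excised to \<open>H\<^sub>n(V, V - K)\<close> and pushed forward
  along \<open>g\<close>, becomes \<open>d\<close> times its own restriction to \<open>H\<^sub>n(E, E - {0})\<close>. Excision is
  expressed by quantifying over the classes \<open>b\<close> of \<open>H\<^sub>n(V, V - K)\<close> whose image under inclusion is
  the given one. No orientation needs to be chosen: changing the generator of
  \<open>H\<^sub>n(E, E - B)\<close> changes both sides by the same sign. Homology groups are written multiplicatively.\<close>

definition local_degree :: "'a::euclidean_space set \<Rightarrow> ('a \<Rightarrow> 'a) \<Rightarrow> int" where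
  "local_degree V g =
    (let n = int DIM('a); K = {x \<in> V. g x = 0} in
     THE d. \<exists>R>0. K \<subseteq> cball 0 R \<and>
       (\<forall>a \<in> carrier (relative_homology_group n euclidean (- cball (0::'a) R)).
        \<forall>b \<in> carrier (relative_homology_group n (top_of_set V) (V - K)).
          hom_induced n (top_of_set V) (V - K) euclidean (- K) id b
            = hom_induced n euclidean (- cball 0 R) euclidean (- K) id a \<longrightarrow>
          hom_induced n (top_of_set V) (V - K) euclidean (- {0}) g b
            = hom_induced n euclidean (- cball 0 R) euclidean (- {0}) id a
                [^]\<^bsub>relative_homology_group n euclidean (- {0::'a})\<^esub> d))"

text \<open>The choice of the neighbourhood \<open>W\<close> and of the retraction \<open>r\<close> depends on \<open>X\<close> only; the
  index does not depend on it. A compact polyhedron is a Euclidean neighbourhood retract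
  (\<open>ENR_finite_Union_convex_closed\<close>), so a suitable pair exists.\<close>

definition neighbourhood_retraction :: "'a::euclidean_space set \<Rightarrow> 'a set \<times> ('a \<Rightarrow> 'a)" where
  "neighbourhood_retraction X = (SOME (W, r). open W \<and> retraction W X r)"

definition fixed_point_index ::
    "'a::euclidean_space set \<Rightarrow> ('a \<Rightarrow> 'a) \<Rightarrow> 'a set \<Rightarrow> int" where
  "fixed_point_index X f U =
    (let (W, r) = neighbourhood_retraction X
     in local_degree {x \<in> W. r x \<in> U} (\<lambda>x. x - f (r x)))"

definition combinatorial_index ::
    "'a::euclidean_space set \<Rightarrow> ('a \<Rightarrow> 'a) \<Rightarrow> 'a set \<Rightarrow> int" where
  "combinatorial_index X f A = fixed_point_index X f (top_of_set X interior_of A)"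

text \<open>The sets on which the combinatorial index is defined.\<close>

definition index_admissible ::
    "'a::euclidean_space set \<Rightarrow> ('a \<Rightarrow> 'a) \<Rightarrow> 'a set \<Rightarrow> bool" where
  "index_admissible X f A \<longleftrightarrow>
     A \<subseteq> X \<and> (\<forall>x \<in> top_of_set X closure_of A - top_of_set X interior_of A. f x \<noteq> x)"

text \<open>For \<open>k\<close> that is an integer combination of characteristic functions of admissible sets;
  only the values of \<open>k\<close> on \<open>X\<close> matter. The value is unique because it does not depend on the
  expression chosen for \<open>k\<close>.\<close>

definition index_integral ::
    "'a::euclidean_space set \<Rightarrow> ('a \<Rightarrow> 'a) \<Rightarrow> ('a \<Rightarrow> int) \<Rightarrow> int" where
  "index_integral X f k =
    (THE v. \<exists>(m::nat) (d::nat \<Rightarrow> int) (U::nat \<Rightarrow> 'a set).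
       (\<forall>j<m. index_admissible X f (U j)) \<and>
       (\<forall>x\<in>X. k x = (\<Sum>j<m. d j * indicator (U j) x)) \<and>
       v = (\<Sum>j<m. d j * combinatorial_index X f (U j)))"

definition index_strict :: "'a::euclidean_space set \<Rightarrow> ('a \<Rightarrow> 'a) \<Rightarrow> bool" where
  "index_strict X f \<longleftrightarrow>
     continuous_on X f \<and> f \<in> X \<rightarrow> X \<and>
     ((\<forall>U. openin (top_of_set X) U \<and> (\<forall>x \<in> top_of_set X closure_of U - U. f x \<noteq> x)
           \<longrightarrow> fixed_point_index X f U \<ge> 0) \<or>
      (\<forall>U. openin (top_of_set X) U \<and> (\<forall>x \<in> top_of_set X closure_of U - U. f x \<noteq> x)
           \<longrightarrow> fixed_point_index X f U \<le> 0))"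

definition real_integrable ::
    "'a::euclidean_space set \<Rightarrow> ('a \<Rightarrow> 'a) \<Rightarrow> ('a \<Rightarrow> real) \<Rightarrow> bool" where
  "real_integrable X f h \<longleftrightarrow>
     (\<forall>p\<in>\<rat>. \<forall>x \<in> top_of_set X closure_of {y \<in> X. h y = p}. f x \<noteq> x) \<and>
     (\<forall>p\<in>\<rat>. \<forall>q\<in>\<rat>. p < q \<longrightarrow>
        (\<forall>x \<in> top_of_set X closure_of {y \<in> X. p < h y \<and> h y < q}
              - top_of_set X interior_of {y \<in> X. p < h y \<and> h y < q}. f x \<noteq> x)) \<and>
     bounded (h ` X)"

end

theory Submission
  imports Defs
begin

text \<open>The local degree is additive: if the zero set is the union of disjoint compact sets \<open>K\<^sub>1\<close> and
  \<open>K\<^sub>2\<close>, excision identifies \<open>H\<^sub>n(E - K\<^sub>2, E - K)\<close> with \<open>H\<^sub>n(E, E - K\<^sub>1)\<close>, so by the exact sequence of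
  a triple a class of \<open>H\<^sub>n(E, E - K)\<close> is determined by its restrictions near \<open>K\<^sub>1\<close> and near \<open>K\<^sub>2\<close>.
  Hence the index of an open set depends only on the fixed points in it and is a finitely additive
  function on the clopen subsets of the fixed point set. For an index-strict map it has a
  constant sign, so the integral is well defined and monotone up to this sign. Since
  \<open>2\<lfloor>2\<^sup>nh\<rfloor> \<le> \<lfloor>2\<^sup>n\<^sup>+\<^sup>1h\<rfloor>\<close>, the dyadic integrals of the floor form a bounded monotone sequence; the
  ceiling follows since \<open>-\<lceil>2\<^sup>nh\<rceil>\<close> satisfies the same inequality.\<close>

section \<open>Local homology of a Euclidean space\<close>

lemma iso_imp_bij_betw: "h \<in> iso G H \<Longrightarrow> bij_betw h (carrier G) (carrier H)"
  by (simp add: iso_def)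

lemma (in group) mult_inv_eq_one_imp_eq:
  assumes "a \<in> carrier G" "b \<in> carrier G" "a \<otimes> inv b = \<one>"
  shows "b = a"
  using inv_equality [OF assms(3)] assms by simp

text \<open>The homomorphism factors through the homology of \<open>X\<close> relative to all of
  \<open>topspace X\<close>, which is trivial.\<close>

lemma hom_induced_into_relative_eq_one:
  assumes "continuous_map X Y f" "f \<in> topspace X \<rightarrow> S" "S \<subseteq> topspace Y"
  shows "hom_induced p X T Y S f c = \<one>\<^bsub>relative_homology_group p Y S\<^esub>"
proof -
  have "hom_induced p X (topspace X) Y S f (hom_induced p X (topspace X \<inter> T) X (topspace X) id c)
      = hom_induced p X (topspace X \<inter> T) Y S f c"
    using assms by (subst hom_induced_compose') auto
  moreover have "hom_induced p X (topspace X \<inter> T) X (topspace X) id c = \<one>\<^bsub>relative_homology_group p X (topspace X)\<^esub>"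
    using hom_induced_carrier trivial_relative_homology_group_topspace [of p X]
    by (metis singletonD trivial_group_def)
  moreover have "hom_induced p X (topspace X \<inter> T) Y S f = hom_induced p X T Y S f"
    by (metis hom_induced_restrict inf.idem inf.left_idem)
  ultimately show ?thesis
    by (metis group_relative_homology_group hom_induced_hom hom_one)
qed

text \<open>Pushing all points radially outwards by \<open>R\<close> moves the punctured space into
  the complement of the ball, and every stage of the push maps both sets into themselves.\<close>

lemma trivial_relative_homology_group_punctured:
  fixes R :: real
  assumes "R \<ge> 0"
  shows "trivial_group (relative_homology_group p (top_of_set (- {0::'a::euclidean_space})) (- cball 0 R))"
proof -
  \<comment> \<open>\<open>q t\<close> adds \<open>t * R\<close> to the norm of a nonzero point and
    is affine in \<open>t\<close>, so the straight-line homotopy from \<open>id\<close> to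
    \<open>q 1\<close> passes exactly through the maps \<open>q t\<close>.\<close>
  define q where "q t x = x + (t * R / norm x) *\<^sub>R x" for t and x :: 'a
  have nq: "norm (q t x) = norm x + t * R" if "x \<noteq> 0" "0 \<le> t" for t x
  proof -
    have "q t x = (1 + t * R / norm x) *\<^sub>R x"
      by (simp add: q_def algebra_simps)
    then show ?thesis
      using that assms by (simp add: field_simps)
  qed
  have cont: "continuous_on (- {0}) (q 1)"
    unfolding q_def by (intro continuous_intros) auto
  have sub: "subtopology (top_of_set (- {0::'a})) (- cball 0 R) = top_of_set (- cball 0 R)"
    using assms by (auto simp: subtopology_subtopology inf.absorb2)
  have ho: "homotopic_with (\<lambda>h. True) (top_of_set S) (top_of_set S) (q 1) id"
    if "S \<subseteq> - {0}" and S: "\<And>x t. x \<in> S \<Longrightarrow> 0 \<le> t \<Longrightarrow> t \<le> 1 \<Longrightarrow> q t x \<in> S" for S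
  proof -
    have "homotopic_with_canon (\<lambda>h. True) S S id (q 1)"
    proof (rule homotopic_with_linear)
      show "continuous_on S (q 1)"
        using cont that(1) by (rule continuous_on_subset)
      show "closed_segment (id x) (q 1 x) \<subseteq> S" if "x \<in> S" for x
      proof
        fix y assume "y \<in> closed_segment (id x) (q 1 x)"
        then obtain t where t: "0 \<le> t" "t \<le> 1" and "y = (1 - t) *\<^sub>R x + t *\<^sub>R q 1 x"
          by (auto simp: in_segment)
        then have "y = q t x"
          by (simp add: q_def algebra_simps)
        then show "y \<in> S"
          using S [OF \<open>x \<in> S\<close> t] by simp
      qed
    qed auto
    then show ?thesis
      by (simp add: homotopic_with_symD)
  qed
  show ?thesis
  proof (rule trivial_relative_homology_group_gen)
    show "continuous_map (top_of_set (- {0})) (subtopology (top_of_set (- {0})) (- cball 0 R)) (q 1)"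
      unfolding sub using cont nq [of _ 1] assms
      by (simp add: Pi_iff)
  next
    show "homotopic_with (\<lambda>h. True) (subtopology (top_of_set (- {0})) (- cball 0 R))
        (subtopology (top_of_set (- {0})) (- cball 0 R)) (q 1) id"
      unfolding sub
    proof (rule ho)
      show "q t x \<in> - cball 0 R" if "x \<in> - cball 0 R" "0 \<le> t" "t \<le> 1" for x t
        using nq [of x t] that assms mult_nonneg_nonneg [of t R] by (cases "x = 0") (simp_all del: mult_nonneg_nonneg)
    qed (use assms in auto)
  next
    show "homotopic_with (\<lambda>h. True) (top_of_set (- {0})) (top_of_set (- {0})) (q 1) id"
    proof (rule ho)
      show "q t x \<in> - {0}" if "x \<in> - {0}" "0 \<le> t" "t \<le> 1" for x t
      proof -
        have "norm (q t x) > 0"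
          using nq [of x t] that assms by (simp add: add_pos_nonneg)
        then show ?thesis by auto
      qed
    qed simp
  qed
qed

text \<open>The long exact sequence of the triple (space, punctured space, complement of the ball)
  encloses this map between two trivial groups.\<close>

lemma iso_restrict_cball:
  fixes R :: real
  assumes "R \<ge> 0"
  shows "hom_induced p euclidean (- cball (0::'a::euclidean_space) R) euclidean (- {0}) id
    \<in> iso (relative_homology_group p euclidean (- cball (0::'a) R))
          (relative_homology_group p euclidean (- {0}))"
proof (rule very_short_exact_sequence)
  have sub: "- cball 0 R \<subseteq> - {0::'a}"
    using assms by auto
  show "exact_seq
         ([relative_homology_group (p - 1) (top_of_set (- {0::'a})) (- cball 0 R),
           relative_homology_group p euclidean (- {0::'a}),
           relative_homology_group p euclidean (- cball 0 R),
           relative_homology_group p (top_of_set (- {0})) (- cball 0 R)],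
          [hom_relboundary p euclidean (- {0}) (- cball 0 R),
           hom_induced p euclidean (- cball 0 R) euclidean (- {0}) id,
           hom_induced p (top_of_set (- {0})) (- cball 0 R) euclidean (- cball 0 R) id])"
    using homology_exactness_triple_1 [OF sub, of p euclidean]
      homology_exactness_triple_3 [OF sub, of p euclidean] by fastforce
qed (rule trivial_relative_homology_group_punctured [OF assms])+

text \<open>Since the space is contractible, the group is the reduced homology, one degree lower, of
  the punctured space, and hence of the unit sphere.\<close>

lemma local_homology_group_iso_integer:
  "relative_homology_group (int DIM('a)) euclidean (- {0::'a::euclidean_space}) \<cong> integer_group"
proof -
  \<comment> \<open>\<open>nsphere\<close> consists of points of
    \<open>nat \<Rightarrow> real\<close>; the orthogonal family \<open>Basis\<close>, which spans
    the whole space, carries it to the unit sphere of the abstract type.\<close>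
  obtain f :: "(nat \<Rightarrow> real) \<Rightarrow> 'a" and g
    where fg: "homeomorphic_maps (nsphere (DIM('a) - 1)) (top_of_set (sphere 0 1 \<inter> span Basis)) f g"
    by (rule homeomorphic_maps_nsphere_euclidean_sphere
        [OF independent_Basis [where 'a='a] orthogonal_Basis refl]) auto
  have ne: "- {0::'a} \<noteq> {}"
    by (metis Basis_zero SOME_Basis ComplI empty_iff singletonD)
  have contr: "contractible_space (euclidean :: 'a topology)"
    by (metis contractible_UNIV contractible_space_top_of_set subtopology_UNIV)
  have "relative_homology_group (int DIM('a)) euclidean (- {0::'a})
      \<cong> reduced_homology_group (int DIM('a) - 1) (top_of_set (- {0::'a}))"
    by (rule isomorphic_group_relative_homology_of_contractible [OF contr])
      (simp only: topspace_euclidean Int_UNIV_left ne not_False_eq_True)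
  also have "\<dots> \<cong> reduced_homology_group (int DIM('a) - 1) (top_of_set (sphere (0::'a) 1))"
  proof (rule homotopy_equivalent_space_imp_isomorphic_reduced_homology_groups)
    show "top_of_set (- {0::'a}) homotopy_equivalent_space top_of_set (sphere (0::'a) 1)"
    proof -
      have "affine hull cball (0::'a) 1 - {0} = - {0}"
        by (simp add: affine_hull_nonempty_interior Compl_eq_Diff_UNIV [symmetric])
      then show ?thesis
        using homotopy_eqv_rel_frontier_punctured_affine_hull [of "cball (0::'a) 1" 0]
        by (metis rel_frontier_cball bounded_cball convex_cball homotopy_equivalent_space_sym
            interior_cball rel_interior_interior centre_in_ball affine_hull_nonempty_interior empty_iff zero_less_one zero_neq_one)
    qed
  qed
  also have "\<dots> \<cong> reduced_homology_group (int DIM('a) - 1) (nsphere (DIM('a) - 1))"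
    using fg homeomorphic_space_def homeomorphic_space_sym
    by (intro homeomorphic_space_imp_isomorphic_reduced_homology_groups) fastforce
  also have "\<dots> \<cong> integer_group"
    using reduced_homology_group_nsphere(1) [of "DIM('a) - 1"] by (simp add: of_nat_diff)
  finally show ?thesis .
qed

text \<open>Degrees are exponents in this group; injectivity of the powers of the generator allows
  two exponents to be compared.\<close>

lemma local_homology_group_generator:
  obtains c where "c \<in> carrier (relative_homology_group (int DIM('a)) euclidean (- {0::'a::euclidean_space}))"
    and "\<And>x. x \<in> carrier (relative_homology_group (int DIM('a)) euclidean (- {0::'a})) \<Longrightarrow>
           \<exists>k::int. x = c [^]\<^bsub>relative_homology_group (int DIM('a)) euclidean (- {0::'a})\<^esub> k"
    and "inj (\<lambda>k::int. c [^]\<^bsub>relative_homology_group (int DIM('a)) euclidean (- {0::'a})\<^esub> k)"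
proof -
  let ?G = "relative_homology_group (int DIM('a)) euclidean (- {0::'a})"
  obtain \<phi> where \<phi>: "\<phi> \<in> iso integer_group ?G"
    using local_homology_group_iso_integer group.iso_sym is_iso_def
    by (metis (no_types, lifting) all_not_in_conv group_relative_homology_group)
  then have hom: "\<phi> \<in> hom integer_group ?G" and bij: "bij_betw \<phi> UNIV (carrier ?G)"
    by (auto simp: iso_def)
  have pow: "\<phi> k = \<phi> 1 [^]\<^bsub>?G\<^esub> k" for k
    using group_hom.hom_int_pow [of integer_group ?G \<phi> 1 k] hom
    by (simp add: group_hom_def group_hom_axioms_def)
  show thesis
  proof
    show "\<phi> 1 \<in> carrier ?G"
      using bij by (auto simp: bij_betw_def)
    show "\<exists>k::int. x = \<phi> 1 [^]\<^bsub>?G\<^esub> k" if "x \<in> carrier ?G" for x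
      using bij pow that unfolding bij_betw_def by (metis imageE)
    show "inj (\<lambda>k::int. \<phi> 1 [^]\<^bsub>?G\<^esub> k)"
      using bij unfolding bij_betw_def pow [symmetric] by simp
  qed
qed

text \<open>\<open>- V\<close> can be excised: it is closed and contained in the open set
  \<open>- K\<close>.\<close>

lemma iso_excise_to_euclidean:
  fixes V :: "'a::euclidean_space set"
  assumes "open V" "closed K" "K \<subseteq> V"
  shows "hom_induced p (top_of_set V) (V - K) euclidean (- K) id
    \<in> iso (relative_homology_group p (top_of_set V) (V - K)) (relative_homology_group p euclidean (- K))"
proof -
  have "euclidean closure_of (- V) \<subseteq> euclidean interior_of (- K)"
    using assms by (simp add: closure_closed interior_open open_Compl closed_Compl)
  moreover have "UNIV - (- V) = V" "- K - (- V) = V - K"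
    by auto
  ultimately show ?thesis
    using homology_excision_axiom [of euclidean "- V" "- K" UNIV p] by simp
qed

text \<open>By exactness for the triple, a class that vanishes near \<open>K2\<close> comes from a
  class \<open>y\<close> of the pair \<open>- K2\<close>, \<open>- (K1 \<union> K2)\<close>.
  Excising \<open>K2\<close> sends \<open>y\<close> to the restriction of \<open>x\<close> near
  \<open>K1\<close>, which vanishes as well, and this excision map is injective.\<close>

lemma local_homology_disjoint_union_eq_one:
  fixes K1 K2 :: "'a::euclidean_space set"
  assumes "closed K1" "closed K2" "K1 \<inter> K2 = {}"
    and x: "x \<in> carrier (relative_homology_group p euclidean (- (K1 \<union> K2)))"
    and x1: "hom_induced p euclidean (- (K1 \<union> K2)) euclidean (- K1) id x
              = \<one>\<^bsub>relative_homology_group p euclidean (- K1)\<^esub>"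
    and x2: "hom_induced p euclidean (- (K1 \<union> K2)) euclidean (- K2) id x
              = \<one>\<^bsub>relative_homology_group p euclidean (- K2)\<^esub>"
  shows "x = \<one>\<^bsub>relative_homology_group p euclidean (- (K1 \<union> K2))\<^esub>"
proof -
  let ?K = "K1 \<union> K2"
  let ?\<iota> = "hom_induced p (top_of_set (- K2)) (- ?K) euclidean (- ?K) id"
  have "- ?K \<subseteq> - K2"
    by auto
  from homology_exactness_triple_3 [OF this, of p euclidean] x x2
  have "x \<in> ?\<iota> ` carrier (relative_homology_group p (top_of_set (- K2)) (- ?K))"
    by (simp add: kernel_def) blast
  then obtain y where y: "y \<in> carrier (relative_homology_group p (top_of_set (- K2)) (- ?K))" and xy: "x = ?\<iota> y"
    by blast
  have "hom_induced p (top_of_set (- K2)) (- K2 - K1) euclidean (- K1) id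
      \<in> iso (relative_homology_group p (top_of_set (- K2)) (- K2 - K1)) (relative_homology_group p euclidean (- K1))"
    using assms by (intro iso_excise_to_euclidean) auto
  moreover have "- K2 - K1 = - ?K"
    by auto
  ultimately have iso: "hom_induced p (top_of_set (- K2)) (- ?K) euclidean (- K1) id
      \<in> iso (relative_homology_group p (top_of_set (- K2)) (- ?K)) (relative_homology_group p euclidean (- K1))"
    by simp
  have "hom_induced p (top_of_set (- K2)) (- ?K) euclidean (- K1) id y
      = hom_induced p euclidean (- ?K) euclidean (- K1) id x"
    unfolding xy by (subst hom_induced_compose') auto
  then have "hom_induced p (top_of_set (- K2)) (- ?K) euclidean (- K1) id y
      = hom_induced p (top_of_set (- K2)) (- ?K) euclidean (- K1) id
          \<one>\<^bsub>relative_homology_group p (top_of_set (- K2)) (- ?K)\<^esub>"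
    using x1 by (simp add: hom_one [OF hom_induced_hom])
  then have "y = \<one>\<^bsub>relative_homology_group p (top_of_set (- K2)) (- ?K)\<^esub>"
    by (rule inj_onD [OF bij_betw_imp_inj_on [OF iso_imp_bij_betw [OF iso]] _ y]) (simp add: group.is_monoid)
  then show ?thesis
    using xy by (simp add: hom_one [OF hom_induced_hom])
qed

section \<open>Local degree\<close>

text \<open>The condition under the quantifier over \<open>R\<close> in \<open>local_degree\<close>,
  isolated so that different radii can be compared.\<close>

definition represents_degree :: "'a::euclidean_space set \<Rightarrow> ('a \<Rightarrow> 'a) \<Rightarrow> real \<Rightarrow> int \<Rightarrow> bool" where
  "represents_degree V g R d \<longleftrightarrow>
    (let n = int DIM('a); K = {x \<in> V. g x = 0} in
      \<forall>a \<in> carrier (relative_homology_group n euclidean (- cball (0::'a) R)).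
      \<forall>b \<in> carrier (relative_homology_group n (top_of_set V) (V - K)).
        hom_induced n (top_of_set V) (V - K) euclidean (- K) id b
          = hom_induced n euclidean (- cball 0 R) euclidean (- K) id a \<longrightarrow>
        hom_induced n (top_of_set V) (V - K) euclidean (- {0}) g b
          = hom_induced n euclidean (- cball 0 R) euclidean (- {0}) id a
              [^]\<^bsub>relative_homology_group n euclidean (- {0::'a})\<^esub> d)"

lemma local_degree_eq_The_represents:
  "local_degree V g = (THE d. \<exists>R>0. {x \<in> V. g x = 0} \<subseteq> cball 0 R \<and> represents_degree V g R d)"
  unfolding local_degree_def represents_degree_def Let_def ..

text \<open>A class relative to the complement of the larger ball restricts to one for the smaller
  ball. The restrictions to the zero set and to the origin factor through it because both lie in the
  smaller ball.\<close>

lemma represents_degree_mono: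
  fixes R S :: real
  assumes "represents_degree V g R d" "0 \<le> R" "R \<le> S" and K: "{x \<in> V. g x = 0} \<subseteq> cball 0 R"
  shows "represents_degree V g S d"
  unfolding represents_degree_def Let_def
proof (intro ballI impI)
  let ?n = "int DIM('a)" and ?K = "{x \<in> V. g x = 0}"
  fix a b
  assume b: "b \<in> carrier (relative_homology_group ?n (top_of_set V) (V - ?K))"
    and ab: "hom_induced ?n (top_of_set V) (V - ?K) euclidean (- ?K) id b
          = hom_induced ?n euclidean (- cball 0 S) euclidean (- ?K) id a"
  define a' where "a' = hom_induced ?n euclidean (- cball 0 S) euclidean (- cball (0::'a) R) id a"
  have restrict: "hom_induced ?n euclidean (- cball 0 S) euclidean (- T) id a
      = hom_induced ?n euclidean (- cball 0 R) euclidean (- T) id a'" if "T \<subseteq> cball 0 R" for T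
    unfolding a'_def using that \<open>R \<le> S\<close> by (subst hom_induced_compose') auto
  have "a' \<in> carrier (relative_homology_group ?n euclidean (- cball (0::'a) R))"
    unfolding a'_def by (rule hom_induced_carrier)
  moreover have "hom_induced ?n (top_of_set V) (V - ?K) euclidean (- ?K) id b
          = hom_induced ?n euclidean (- cball 0 R) euclidean (- ?K) id a'"
    using ab restrict [OF K] by (rule trans)
  ultimately have "hom_induced ?n (top_of_set V) (V - ?K) euclidean (- {0}) g b
          = hom_induced ?n euclidean (- cball 0 R) euclidean (- {0}) id a'
              [^]\<^bsub>relative_homology_group ?n euclidean (- {0::'a})\<^esub> d"
    using assms(1) b unfolding represents_degree_def Let_def by blast
  also have "hom_induced ?n euclidean (- cball 0 R) euclidean (- {0}) id a'
      = hom_induced ?n euclidean (- cball 0 S) euclidean (- {0}) id a"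
    using \<open>0 \<le> R\<close> by (intro restrict [symmetric]) auto
  finally show "hom_induced ?n (top_of_set V) (V - ?K) euclidean (- {0}) g b
          = hom_induced ?n euclidean (- cball 0 S) euclidean (- {0}) id a
              [^]\<^bsub>relative_homology_group ?n euclidean (- {0::'a})\<^esub> d" .
qed

text \<open>The classes \<open>a\<close> form an infinite cyclic group and excision makes
  \<open>b\<close> a function of \<open>a\<close>, so the condition need only be tested on a
  generator.\<close>

lemma local_degree_unique_at_radius:
  fixes V :: "'a::euclidean_space set"
  assumes "open V" "continuous_on V g" "compact {x \<in> V. g x = 0}"
    and "R > 0" "{x \<in> V. g x = 0} \<subseteq> cball 0 R"
  shows "\<exists>!d. represents_degree V g R d"
proof -
  let ?n = "int DIM('a)" and ?K = "{x \<in> V. g x = 0}"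
  let ?G = "relative_homology_group ?n euclidean (- {0::'a})"
  let ?A = "relative_homology_group ?n euclidean (- cball (0::'a) R)"
  let ?B = "relative_homology_group ?n (top_of_set V) (V - ?K)"
  let ?E = "relative_homology_group ?n euclidean (- ?K)"
  let ?\<rho> = "hom_induced ?n euclidean (- cball (0::'a) R) euclidean (- {0}) id"
  let ?res = "hom_induced ?n euclidean (- cball (0::'a) R) euclidean (- ?K) id"
  let ?exc = "hom_induced ?n (top_of_set V) (V - ?K) euclidean (- ?K) id"
  let ?g = "hom_induced ?n (top_of_set V) (V - ?K) euclidean (- {0}) g"
  have hom: "group_hom ?A ?G ?\<rho>" "group_hom ?A ?E ?res" "group_hom ?B ?E ?exc" "group_hom ?B ?G ?g"
    by (simp_all add: group_hom_def group_hom_axioms_def hom_induced_hom)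
  obtain c where c: "c \<in> carrier ?G" and gen: "\<And>x. x \<in> carrier ?G \<Longrightarrow> \<exists>k::int. x = c [^]\<^bsub>?G\<^esub> k"
    and inj: "inj (\<lambda>k::int. c [^]\<^bsub>?G\<^esub> k)"
    using local_homology_group_generator by metis
  have \<rho>: "bij_betw ?\<rho> (carrier ?A) (carrier ?G)"
    using \<open>R > 0\<close> by (intro iso_imp_bij_betw iso_restrict_cball less_imp_le)
  have exc: "bij_betw ?exc (carrier ?B) (carrier ?E)"
    using assms(1) compact_imp_closed [OF assms(3)] by (rule iso_imp_bij_betw [OF iso_excise_to_euclidean]) blast
  \<comment> \<open>\<open>a0\<close> lifts the generator \<open>c\<close> to the group of the ball
    and \<open>b0\<close> is its counterpart near the zero set; the exponent of the image of
    \<open>b0\<close> under \<open>?g\<close> is the degree.\<close>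
  have "c \<in> ?\<rho> ` carrier ?A"
    unfolding bij_betw_imp_surj_on [OF \<rho>] by (rule c)
  then obtain a0 where a0: "c = ?\<rho> a0" "a0 \<in> carrier ?A"
    by (rule imageE)
  have "?res a0 \<in> ?exc ` carrier ?B"
    unfolding bij_betw_imp_surj_on [OF exc] by (rule hom_induced_carrier)
  then obtain b0 where b0: "?res a0 = ?exc b0" "b0 \<in> carrier ?B"
    by (rule imageE)
  obtain d :: int where d: "?g b0 = c [^]\<^bsub>?G\<^esub> d"
    using gen [OF hom_induced_carrier] by blast
  show ?thesis
  proof
    show "represents_degree V g R d"
      unfolding represents_degree_def Let_def
    proof (intro ballI impI)
      fix a b assume a: "a \<in> carrier ?A" and b: "b \<in> carrier ?B" and ab: "?exc b = ?res a"
      \<comment> \<open>By injectivity of \<open>?\<rho>\<close> and \<open>?exc\<close>, the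
        classes \<open>a\<close> and \<open>b\<close> are the \<open>k\<close>-th powers of
        \<open>a0\<close> and \<open>b0\<close> with the same \<open>k\<close>; the exponents
        \<open>d\<close> and \<open>k\<close> of \<open>c\<close> can then be interchanged.\<close>
      obtain k :: int where k: "?\<rho> a = c [^]\<^bsub>?G\<^esub> k"
        using gen [OF hom_induced_carrier] by blast
      have "?\<rho> a = ?\<rho> (a0 [^]\<^bsub>?A\<^esub> k)"
        unfolding group_hom.hom_int_pow [OF hom(1) a0(2)] a0(1) [symmetric] by (rule k)
      then have ak: "a = a0 [^]\<^bsub>?A\<^esub> k"
        by (rule inj_onD [OF bij_betw_imp_inj_on [OF \<rho>] _ a])
          (intro group.int_pow_closed group_relative_homology_group a0)
      have "?exc b = ?exc (b0 [^]\<^bsub>?B\<^esub> k)"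
        unfolding ab ak group_hom.hom_int_pow [OF hom(2) a0(2)] group_hom.hom_int_pow [OF hom(3) b0(2)] b0(1) ..
      then have bk: "b = b0 [^]\<^bsub>?B\<^esub> k"
        by (rule inj_onD [OF bij_betw_imp_inj_on [OF exc] _ b])
          (intro group.int_pow_closed group_relative_homology_group b0)
      have "?g b = (c [^]\<^bsub>?G\<^esub> d) [^]\<^bsub>?G\<^esub> k"
        unfolding bk group_hom.hom_int_pow [OF hom(4) b0(2)] d ..
      also have "\<dots> = ?\<rho> a [^]\<^bsub>?G\<^esub> d"
        unfolding k using c by (simp add: group.int_pow_pow mult.commute)
      finally show "?g b = ?\<rho> a [^]\<^bsub>?G\<^esub> d" .
    qed
  next
    fix e assume "represents_degree V g R e"
    then have "?g b0 = ?\<rho> a0 [^]\<^bsub>?G\<^esub> e"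
      unfolding represents_degree_def Let_def using a0(2) b0(1) [symmetric] b0(2) by blast
    then have "c [^]\<^bsub>?G\<^esub> e = c [^]\<^bsub>?G\<^esub> d"
      unfolding a0(1) [symmetric] d by (rule sym)
    then show "e = d"
      by (rule injD [OF inj])
  qed
qed

text \<open>Values found at two radii both persist at the larger one, where they agree. Hence the
  description in \<open>local_degree\<close> has a unique solution, and every positive radius whose
  ball contains the zeros computes it.\<close>

lemma represents_degree_local_degree:
  fixes V :: "'a::euclidean_space set"
  assumes "open V" "continuous_on V g" "compact {x \<in> V. g x = 0}"
    and "R > 0" "{x \<in> V. g x = 0} \<subseteq> cball 0 R"
  shows "represents_degree V g R (local_degree V g)"
proof -
  let ?K = "{x \<in> V. g x = 0}"
  have ex1: "\<exists>!d. represents_degree V g S d" if "S > 0" "?K \<subseteq> cball 0 S" for S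
    using local_degree_unique_at_radius assms(1-3) that by blast
  have eq: "d = e" if "S > 0" "?K \<subseteq> cball 0 S" "represents_degree V g S d"
    "T > 0" "?K \<subseteq> cball 0 T" "represents_degree V g T e" for S T d e
  proof -
    have "represents_degree V g (max S T) d" "represents_degree V g (max S T) e"
      using represents_degree_mono that by (metis less_imp_le max.cobounded1 max.cobounded2)+
    then show ?thesis
      using ex1 [of "max S T"] that by (metis max.strict_coboundedI1 subset_cball max.cobounded1 subset_trans)
  qed
  have "\<exists>!d. \<exists>S>0. ?K \<subseteq> cball 0 S \<and> represents_degree V g S d"
    using ex1 [OF assms(4,5)] assms(4,5) eq by blast
  then have "\<exists>S>0. ?K \<subseteq> cball 0 S \<and> represents_degree V g S (local_degree V g)"
    unfolding local_degree_eq_The_represents by (rule theI')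
  then show ?thesis
    using ex1 [OF assms(4,5)] assms(4,5) eq by blast
qed

text \<open>\<open>V1\<close> and \<open>V2\<close> may overlap away from the zeros. The class on
  \<open>V\<close> is assembled from one class on \<open>V1\<close> and one on \<open>V2\<close>,
  and \<open>g\<close> pushes the product forward factor by factor.\<close>

lemma local_degree_additive:
  fixes V :: "'a::euclidean_space set"
  assumes "open V" "continuous_on V g" and cK: "compact {x \<in> V. g x = 0}"
    and V1: "open V1" "V1 \<subseteq> V" and V2: "open V2" "V2 \<subseteq> V"
    and cover: "{x \<in> V. g x = 0} \<subseteq> V1 \<union> V2" and disj: "{x \<in> V1 \<inter> V2. g x = 0} = {}"
  shows "local_degree V g = local_degree V1 g + local_degree V2 g"
proof -
  let ?n = "int DIM('a)"
  define K where "K = {x \<in> V. g x = 0}"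
  define K1 where "K1 = {x \<in> V1. g x = 0}"
  define K2 where "K2 = {x \<in> V2. g x = 0}"
  have K: "K = K1 \<union> K2" and K12: "K1 \<inter> K2 = {}" "V1 \<inter> K2 = {}" "V2 \<inter> K1 = {}"
    using V1 V2 cover disj by (auto simp: K_def K1_def K2_def)
  have "compact K1" "compact K2"
  proof -
    \<comment> \<open>Removing the open set \<open>V2\<close> cuts \<open>K1\<close> out of the
      compact set \<open>K\<close>, so compactness is inherited.\<close>
    have "K1 = K - V2" "K2 = K - V1"
      using V1 V2 cover disj by (auto simp: K_def K1_def K2_def)
    then show "compact K1" "compact K2"
      using cK V1 V2 by (simp_all add: K_def compact_diff)
  qed
  obtain R where R: "R > 0" "K \<subseteq> cball 0 R"
    using compact_imp_bounded [OF cK] by (auto simp: K_def bounded_pos subset_iff)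
  let ?G = "relative_homology_group ?n euclidean (- {0::'a})"
  let ?A = "relative_homology_group ?n euclidean (- cball (0::'a) R)"
  let ?E = "relative_homology_group ?n euclidean (- K)"
  let ?B = "relative_homology_group ?n (top_of_set V) (V - K)"
  let ?\<rho> = "hom_induced ?n euclidean (- cball (0::'a) R) euclidean (- {0}) id"
  let ?res = "\<lambda>T. hom_induced ?n euclidean (- cball (0::'a) R) euclidean (- T) id"
  let ?push = "\<lambda>U T. hom_induced ?n (top_of_set U) (U - T) euclidean (- {0}) g"
  let ?exc = "\<lambda>U T. hom_induced ?n (top_of_set U) (U - T) euclidean (- T) id"
  let ?\<iota> = "\<lambda>U T. hom_induced ?n (top_of_set U) (U - T) (top_of_set V) (V - K) id"
  obtain c where c: "c \<in> carrier ?G" and inj: "inj (\<lambda>k::int. c [^]\<^bsub>?G\<^esub> k)"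
    using local_homology_group_generator by metis
  have "bij_betw ?\<rho> (carrier ?A) (carrier ?G)"
    using \<open>R > 0\<close> by (intro iso_imp_bij_betw iso_restrict_cball less_imp_le)
  from bij_betw_imp_surj_on [OF this] c have "c \<in> ?\<rho> ` carrier ?A"
    by (simp only:)
  then obtain a where a: "c = ?\<rho> a" "a \<in> carrier ?A"
    by (rule imageE)
  have lift: "\<exists>b \<in> carrier (relative_homology_group ?n (top_of_set U) (U - T)). ?exc U T b = ?res T a"
    if "open U" "compact T" "T \<subseteq> U" for U T
  proof -
    have "bij_betw (?exc U T) (carrier (relative_homology_group ?n (top_of_set U) (U - T)))
        (carrier (relative_homology_group ?n euclidean (- T)))"
      by (intro iso_imp_bij_betw iso_excise_to_euclidean that compact_imp_closed)
    from bij_betw_imp_surj_on [OF this]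
    have "?res T a \<in> ?exc U T ` carrier (relative_homology_group ?n (top_of_set U) (U - T))"
      by (simp only: hom_induced_carrier)
    then obtain b where "?res T a = ?exc U T b" "b \<in> carrier (relative_homology_group ?n (top_of_set U) (U - T))"
      by (rule imageE)
    then show ?thesis
      by (intro bexI [of _ b]) (rule sym)
  qed
  have "K1 \<subseteq> V1" "K2 \<subseteq> V2"
    by (auto simp: K1_def K2_def)
  obtain b1 where b1: "b1 \<in> carrier (relative_homology_group ?n (top_of_set V1) (V1 - K1))" "?exc V1 K1 b1 = ?res K1 a"
    using lift [OF V1(1) \<open>compact K1\<close> \<open>K1 \<subseteq> V1\<close>] by (elim bexE)
  obtain b2 where b2: "b2 \<in> carrier (relative_homology_group ?n (top_of_set V2) (V2 - K2))" "?exc V2 K2 b2 = ?res K2 a"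
    using lift [OF V2(1) \<open>compact K2\<close> \<open>K2 \<subseteq> V2\<close>] by (elim bexE)
  define b where "b = ?\<iota> V1 K1 b1 \<otimes>\<^bsub>?B\<^esub> ?\<iota> V2 K2 b2"
  have b: "b \<in> carrier ?B"
    unfolding b_def by (simp add: group.is_monoid hom_induced_carrier monoid.m_closed)

  define x1 where "x1 = hom_induced ?n (top_of_set V1) (V1 - K1) euclidean (- K) id b1"
  define x2 where "x2 = hom_induced ?n (top_of_set V2) (V2 - K2) euclidean (- K) id b2"
  \<comment> \<open>\<open>x\<close> is the discrepancy between the restriction of \<open>a\<close>
    and the image of the candidate \<open>b\<close>; it is trivial once it vanishes near
    \<open>K1\<close> and near \<open>K2\<close>.\<close>
  define x where "x = ?res K a \<otimes>\<^bsub>?E\<^esub> inv\<^bsub>?E\<^esub> (x1 \<otimes>\<^bsub>?E\<^esub> x2)"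
  have xc: "?res K a \<in> carrier ?E" "x1 \<in> carrier ?E" "x2 \<in> carrier ?E"
    unfolding x1_def x2_def by (rule hom_induced_carrier)+
  have excb: "?exc V K b = x1 \<otimes>\<^bsub>?E\<^esub> x2"
  proof -
    have "?exc V K b = ?exc V K (?\<iota> V1 K1 b1) \<otimes>\<^bsub>?E\<^esub> ?exc V K (?\<iota> V2 K2 b2)"
      unfolding b_def by (intro hom_mult [OF hom_induced_hom] hom_induced_carrier)
    also have "?exc V K (?\<iota> V1 K1 b1) = x1"
      unfolding x1_def using V1 K K12
      by (subst hom_induced_compose') (auto simp: continuous_map_from_subtopology)
    also have "?exc V K (?\<iota> V2 K2 b2) = x2"
      unfolding x2_def using V2 K K12
      by (subst hom_induced_compose') (auto simp: continuous_map_from_subtopology)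
    finally show ?thesis .
  qed
  have "x = \<one>\<^bsub>?E\<^esub>"
  proof -
    have xE: "x \<in> carrier ?E"
      unfolding x_def using xc by (simp add: group.is_monoid monoid.m_closed)
    have one: "hom_induced ?n euclidean (- K) euclidean (- T) id x = \<one>\<^bsub>relative_homology_group ?n euclidean (- T)\<^esub>"
      if T: "T \<subseteq> K"
        and eq: "hom_induced ?n euclidean (- K) euclidean (- T) id x1 \<otimes>\<^bsub>relative_homology_group ?n euclidean (- T)\<^esub>
          hom_induced ?n euclidean (- K) euclidean (- T) id x2 = ?res T a" for T
    proof -
      let ?f = "hom_induced ?n euclidean (- K) euclidean (- T) id"
      let ?H = "relative_homology_group ?n euclidean (- T)"
      have f: "group_hom ?E ?H ?f"
        by (simp add: group_hom_def group_hom_axioms_def hom_induced_hom)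
      have "?f (?res K a) = ?res T a"
        using T R by (subst hom_induced_compose') auto
      then have "?f x = ?res T a \<otimes>\<^bsub>?H\<^esub> inv\<^bsub>?H\<^esub> ?res T a"
        unfolding x_def using xc eq
        by (simp add: group_hom.hom_mult [OF f] group_hom.hom_inv [OF f] group.is_monoid monoid.m_closed)
      also have "\<dots> = \<one>\<^bsub>?H\<^esub>"
        by (intro group.r_inv group_relative_homology_group hom_induced_carrier)
      finally show ?thesis .
    qed
    have "hom_induced ?n euclidean (- K) euclidean (- K1) id x1 = ?res K1 a"
      unfolding x1_def b1(2) [symmetric] using K K12 by (subst hom_induced_compose') (auto simp: K1_def)
    \<comment> \<open>\<open>b2\<close> lives on \<open>V2\<close>, which avoids \<open>K1\<close>,
      so its image relative to \<open>- K1\<close> is trivial.\<close>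
    moreover have "hom_induced ?n euclidean (- K) euclidean (- K1) id x2
        = \<one>\<^bsub>relative_homology_group ?n euclidean (- K1)\<^esub>"
    proof -
      have "hom_induced ?n euclidean (- K) euclidean (- K1) id x2
          = hom_induced ?n (top_of_set V2) (V2 - K2) euclidean (- K1) id b2"
        unfolding x2_def using K K12 by (subst hom_induced_compose') auto
      also have "\<dots> = \<one>\<^bsub>relative_homology_group ?n euclidean (- K1)\<^esub>"
        using K12 by (intro hom_induced_into_relative_eq_one) (auto simp: continuous_map_from_subtopology)
      finally show ?thesis .
    qed
    ultimately have 1: "hom_induced ?n euclidean (- K) euclidean (- K1) id x = \<one>\<^bsub>relative_homology_group ?n euclidean (- K1)\<^esub>"
      by (intro one) (use K in blast, simp only: hom_induced_carrier monoid.r_one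
          [OF group.is_monoid [OF group_relative_homology_group]])
    have "hom_induced ?n euclidean (- K) euclidean (- K2) id x2 = ?res K2 a"
      unfolding x2_def b2(2) [symmetric] using K K12 by (subst hom_induced_compose') (auto simp: K2_def)
    moreover have "hom_induced ?n euclidean (- K) euclidean (- K2) id x1
        = \<one>\<^bsub>relative_homology_group ?n euclidean (- K2)\<^esub>"
    proof -
      have "hom_induced ?n euclidean (- K) euclidean (- K2) id x1
          = hom_induced ?n (top_of_set V1) (V1 - K1) euclidean (- K2) id b1"
        unfolding x1_def using K K12 by (subst hom_induced_compose') auto
      also have "\<dots> = \<one>\<^bsub>relative_homology_group ?n euclidean (- K2)\<^esub>"
        using K12 by (intro hom_induced_into_relative_eq_one) (auto simp: continuous_map_from_subtopology)
      finally show ?thesis .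
    qed
    ultimately have 2: "hom_induced ?n euclidean (- K) euclidean (- K2) id x = \<one>\<^bsub>relative_homology_group ?n euclidean (- K2)\<^esub>"
      by (intro one) (use K in blast, simp only: hom_induced_carrier monoid.l_one
          [OF group.is_monoid [OF group_relative_homology_group]])
    show ?thesis
      using local_homology_disjoint_union_eq_one [of K1 K2 x ?n] xE 1 2 K12
        compact_imp_closed [OF \<open>compact K1\<close>] compact_imp_closed [OF \<open>compact K2\<close>]
      unfolding K by blast
  qed
  then have "?exc V K b = ?res K a"
    unfolding excb x_def
    by (rule group.mult_inv_eq_one_imp_eq [OF group_relative_homology_group xc(1)
          monoid.m_closed [OF group.is_monoid [OF group_relative_homology_group] xc(2,3)]])
  moreover have "?push V K b = ?push V1 K1 b1 \<otimes>\<^bsub>?G\<^esub> ?push V2 K2 b2"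
  proof -
    have "?push V K b = ?push V K (?\<iota> V1 K1 b1) \<otimes>\<^bsub>?G\<^esub> ?push V K (?\<iota> V2 K2 b2)"
      unfolding b_def by (intro hom_mult [OF hom_induced_hom] hom_induced_carrier)
    also have "?push V K (?\<iota> V1 K1 b1) = ?push V1 K1 b1"
      using V1 K K12 assms(2) 
      by (subst hom_induced_compose') (auto simp: K_def)
    also have "?push V K (?\<iota> V2 K2 b2) = ?push V2 K2 b2"
      using V2 K K12 assms(2) 
      by (subst hom_induced_compose') (auto simp: K_def)
    finally show ?thesis .
  qed
  \<comment> \<open>All three degrees are read off from the same \<open>a\<close> at the same
    radius, since the ball contains \<open>K\<close> and with it \<open>K1\<close> and
    \<open>K2\<close>.\<close>
  moreover have "?push V K b = ?\<rho> a [^]\<^bsub>?G\<^esub> local_degree V g"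
    using represents_degree_local_degree [OF assms(1,2) cK \<open>R > 0\<close>] R(2) a(2) b \<open>?exc V K b = ?res K a\<close>
    unfolding represents_degree_def Let_def K_def [symmetric] by blast
  moreover have "?push V1 K1 b1 = ?\<rho> a [^]\<^bsub>?G\<^esub> local_degree V1 g"
    using represents_degree_local_degree [OF V1(1) continuous_on_subset [OF assms(2) V1(2)], of R]
      \<open>R > 0\<close> \<open>compact K1\<close> R(2) a(2) b1
    unfolding represents_degree_def Let_def K1_def [symmetric] K by blast
  moreover have "?push V2 K2 b2 = ?\<rho> a [^]\<^bsub>?G\<^esub> local_degree V2 g"
    using represents_degree_local_degree [OF V2(1) continuous_on_subset [OF assms(2) V2(2)], of R]
      \<open>R > 0\<close> \<open>compact K2\<close> R(2) a(2) b2
    unfolding represents_degree_def Let_def K2_def [symmetric] K by blast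
  ultimately have "c [^]\<^bsub>?G\<^esub> local_degree V g
      = c [^]\<^bsub>?G\<^esub> local_degree V1 g \<otimes>\<^bsub>?G\<^esub> c [^]\<^bsub>?G\<^esub> local_degree V2 g"
    unfolding a(1) by (simp only:)
  then have "c [^]\<^bsub>?G\<^esub> (local_degree V g) = c [^]\<^bsub>?G\<^esub> (local_degree V1 g + local_degree V2 g)"
    using c by (simp add: group.int_pow_mult)
  then show ?thesis
    by (rule injD [OF inj])
qed

section \<open>Fixed point index\<close>

lemma polyhedron_compact_ENR:
  assumes "simplicial_complex \<K>"
  shows "compact (\<Union>\<K>)" "ENR (\<Union>\<K>)"
proof -
  have simplex: "\<exists>n. n simplex S" if "S \<in> \<K>" for S
    using assms that by (auto simp: simplicial_complex_def)
  have "compact S \<and> convex S" if "S \<in> \<K>" for S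
    using simplex [OF that] simplex_imp_polytope polytope_imp_compact polytope_imp_convex by blast
  moreover have "finite \<K>"
    using assms by (simp add: simplicial_complex_def)
  ultimately show "compact (\<Union>\<K>)" "ENR (\<Union>\<K>)"
    by (auto intro!: compact_Union ENR_finite_Union_convex_closed compact_imp_closed)
qed

lemma neighbourhood_retraction:
  assumes "ENR X" "neighbourhood_retraction X = (W, r)"
  shows "open W" "retraction W X r"
proof -
  obtain W' r' where "open W'" "retraction W' X r'"
    using assms(1) by (auto simp: ENR_def retract_of_def)
  then have "\<exists>p. case p of (W, r) \<Rightarrow> open W \<and> retraction W X r"
    by auto
  then have "case neighbourhood_retraction X of (W, r) \<Rightarrow> open W \<and> retraction W X r"
    unfolding neighbourhood_retraction_def by (rule someI_ex)
  then show "open W" "retraction W X r"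
    by (auto simp: assms(2))
qed

text \<open>Preimages under the retraction turn open sets of \<open>X\<close> into open sets of the
  ambient space, where additivity of the local degree applies.\<close>

lemma fixed_point_index_additive:
  fixes X :: "'a::euclidean_space set"
  assumes "ENR X" and f: "continuous_on X f" "f \<in> X \<rightarrow> X"
    and U: "openin (top_of_set X) U" "openin (top_of_set X) U1" "openin (top_of_set X) U2"
    and sub: "U1 \<subseteq> U" "U2 \<subseteq> U"
    and comp: "compact {x \<in> U. f x = x}"
    and cover: "{x \<in> U. f x = x} \<subseteq> U1 \<union> U2" and disj: "{x \<in> U1 \<inter> U2. f x = x} = {}"
  shows "fixed_point_index X f U = fixed_point_index X f U1 + fixed_point_index X f U2"
proof -
  obtain W r where Wr: "neighbourhood_retraction X = (W, r)"
    by fastforce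
  have W: "open W" and r: "retraction W X r"
    using neighbourhood_retraction [OF assms(1) Wr] by auto
  have cr: "continuous_on W r" and rX: "\<And>x. x \<in> W \<Longrightarrow> r x \<in> X" and rid: "\<And>x. x \<in> X \<Longrightarrow> r x = x" and "X \<subseteq> W"
    using r by (auto simp: retraction_def)
  let ?V = "\<lambda>U. {x \<in> W. r x \<in> U}" and ?g = "\<lambda>x. x - f (r x)"
  \<comment> \<open>A zero of \<open>?g\<close> equals \<open>f (r x)\<close>, hence lies in
    \<open>X\<close> and is fixed by \<open>r\<close>; no zeros arise outside
    \<open>X\<close>.\<close>
  have zeros: "{x \<in> ?V U'. ?g x = 0} = {x \<in> U'. f x = x}" if "openin (top_of_set X) U'" for U'
  proof -
    have "U' \<subseteq> X"
      using that openin_imp_subset by blast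
    then have 1: "x \<in> W \<and> r x = x" if "x \<in> U'" for x
      using that rid \<open>X \<subseteq> W\<close> by blast
    have 2: "r x = x" if "x \<in> W" "x - f (r x) = 0" for x
    proof -
      have "f (r x) \<in> X"
        using f(2) rX [OF that(1)] by (rule funcset_mem)
      then show ?thesis
        using that(2) rid by simp
    qed
    show ?thesis
    proof (intro equalityI subsetI)
      fix x assume "x \<in> {x \<in> ?V U'. ?g x = 0}"
      then show "x \<in> {x \<in> U'. f x = x}"
        using 2 [of x] by simp
    next
      fix x assume "x \<in> {x \<in> U'. f x = x}"
      then show "x \<in> {x \<in> ?V U'. ?g x = 0}"
        using 1 [of x] by simp
    qed
  qed
  have opn: "open (?V U')" if op: "openin (top_of_set X) U'" for U'
  proof -
    obtain T where T: "open T" "U' = X \<inter> T"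
      using op unfolding openin_open by blast
    then have "?V U' = W \<inter> r -` T"
      using rX by auto
    then show ?thesis
      using continuous_open_preimage [OF cr W T(1)] by simp
  qed
  have "continuous_on (?V U) ?g"
  proof -
    have "continuous_on W (\<lambda>x. f (r x))"
      using continuous_on_compose2 [OF f(1) cr] rX by blast
    then show ?thesis
      by (intro continuous_intros) (auto elim: continuous_on_subset)
  qed
  moreover have "{x \<in> ?V U1 \<inter> ?V U2. ?g x = 0} = {}"
    using zeros [OF U(2)] zeros [OF U(3)] disj by blast
  moreover have "{x \<in> ?V U. ?g x = 0} \<subseteq> ?V U1 \<union> ?V U2"
    using zeros [OF U(1)] zeros [OF U(2)] zeros [OF U(3)] cover by blast
  ultimately have "local_degree (?V U) ?g = local_degree (?V U1) ?g + local_degree (?V U2) ?g"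
    using sub opn [OF U(1)] opn [OF U(2)] opn [OF U(3)] comp zeros [OF U(1)]
    by (intro local_degree_additive) auto
  then show ?thesis
    by (simp add: fixed_point_index_def Wr)
qed

section \<open>Integration with respect to the index\<close>

text \<open>Monotonicity of integration over a ring of sets. Induction splits \<open>D\<close> along
  the first set \<open>C\<close>: on \<open>C \<inter> D\<close> the remaining terms must reach
  \<open>c - e\<close>, on \<open>D - C\<close> they must reach \<open>c\<close>. This avoids a
  common refinement of the sets and is why \<open>c\<close> and \<open>D\<close> vary in the
  induction.\<close>

lemma sum_list_additive_mono:
  fixes \<mu> :: "'a set \<Rightarrow> int"
  assumes pos: "\<And>A. A \<in> \<A> \<Longrightarrow> 0 \<le> \<mu> A"
    and add: "\<And>A B. A \<in> \<A> \<Longrightarrow> B \<in> \<A> \<Longrightarrow> A \<inter> B = {} \<Longrightarrow> \<mu> (A \<union> B) = \<mu> A + \<mu> B"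
    and closed: "\<And>A B. A \<in> \<A> \<Longrightarrow> B \<in> \<A> \<Longrightarrow> A \<inter> B \<in> \<A>" "\<And>A B. A \<in> \<A> \<Longrightarrow> B \<in> \<A> \<Longrightarrow> A - B \<in> \<A>"
    and "D \<in> \<A>" "\<And>e C. (e, C) \<in> set xs \<Longrightarrow> C \<in> \<A>"
    and "\<And>x. x \<in> D \<Longrightarrow> c \<le> (\<Sum>(e, C)\<leftarrow>xs. e * indicator C x)"
  shows "c * \<mu> D \<le> (\<Sum>(e, C)\<leftarrow>xs. e * \<mu> (C \<inter> D))"
  using assms(5-)
proof (induction xs arbitrary: c D)
  case Nil
  \<comment> \<open>The empty sum forces \<open>c \<le> 0\<close> unless \<open>D\<close> is empty;
    in that case both sides vanish.\<close>
  have "\<mu> {} = 0"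
    using add [of "{}" "{}"] closed(2) [OF \<open>D \<in> \<A>\<close> \<open>D \<in> \<A>\<close>] by simp
  then show ?case
    using Nil pos [of D] by (cases "D = {}") (auto intro: mult_nonpos_nonneg)
next
  case (Cons p xs)
  obtain e C where p: "p = (e, C)"
    by fastforce
  have C: "C \<in> \<A>"
    using Cons.prems(2) [of e C] by (simp add: p)
  have split: "\<mu> (B \<inter> D) = \<mu> (B \<inter> (C \<inter> D)) + \<mu> (B \<inter> (D - C))" if "B \<in> \<A>" for B
  proof -
    have "\<mu> (B \<inter> (C \<inter> D) \<union> B \<inter> (D - C)) = \<mu> (B \<inter> (C \<inter> D)) + \<mu> (B \<inter> (D - C))"
      using that C Cons.prems(1) closed by (intro add) auto
    moreover have "B \<inter> (C \<inter> D) \<union> B \<inter> (D - C) = B \<inter> D"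
      by auto
    ultimately show ?thesis by simp
  qed
  have in1: "(c - e) * \<mu> (C \<inter> D) \<le> (\<Sum>(e, B)\<leftarrow>xs. e * \<mu> (B \<inter> (C \<inter> D)))"
  proof (rule Cons.IH)
    show "C \<inter> D \<in> \<A>"
      using C Cons.prems(1) closed by blast
    show "c - e \<le> (\<Sum>(e, B)\<leftarrow>xs. e * indicator B x)" if "x \<in> C \<inter> D" for x
      using Cons.prems(3) [of x] that by (simp add: p)
  qed (use Cons.prems in auto)
  have in2: "c * \<mu> (D - C) \<le> (\<Sum>(e, B)\<leftarrow>xs. e * \<mu> (B \<inter> (D - C)))"
  proof (rule Cons.IH)
    show "D - C \<in> \<A>"
      using C Cons.prems(1) closed by blast
    show "c \<le> (\<Sum>(e, B)\<leftarrow>xs. e * indicator B x)" if "x \<in> D - C" for x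
      using Cons.prems(3) [of x] that by (simp add: p)
  qed (use Cons.prems in auto)
  have "(\<Sum>(e, B)\<leftarrow>xs. e * \<mu> (B \<inter> D))
      = (\<Sum>(e, B)\<leftarrow>xs. e * \<mu> (B \<inter> (C \<inter> D))) + (\<Sum>(e, B)\<leftarrow>xs. e * \<mu> (B \<inter> (D - C)))"
  proof -
    have "(\<Sum>(e, B)\<leftarrow>xs. e * \<mu> (B \<inter> D)) = (\<Sum>(e, B)\<leftarrow>xs. e * \<mu> (B \<inter> (C \<inter> D)) + e * \<mu> (B \<inter> (D - C)))"
    proof (intro arg_cong [where f = sum_list] map_cong refl, clarify)
      fix e B assume "(e, B) \<in> set xs"
      then have "B \<in> \<A>"
        using Cons.prems(2) by auto
      then show "e * \<mu> (B \<inter> D) = e * \<mu> (B \<inter> (C \<inter> D)) + e * \<mu> (B \<inter> (D - C))"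
        using split [of B] by (simp add: distrib_left)
    qed
    then show ?thesis
      by (simp add: case_prod_unfold sum_list_addf)
  qed
  moreover have "\<mu> D = \<mu> (C \<inter> D) + \<mu> (D - C)"
    using split [of D] Cons.prems(1) by (simp add: inf.absorb2 inf.absorb1)
  moreover have "(\<Sum>(e, B)\<leftarrow>p # xs. e * \<mu> (B \<inter> D)) = e * \<mu> (C \<inter> D) + (\<Sum>(e, B)\<leftarrow>xs. e * \<mu> (B \<inter> D))"
    by (simp add: p)
  ultimately show ?case
    using in1 in2 unfolding left_diff_distrib by (simp only: distrib_left)
qed

text \<open>Closure commutes with finite unions, while the interior can only grow beyond the union
  of the interiors; so a fixed point on the boundary of the union would be one on the boundary of
  \<open>A\<close> or \<open>B\<close>.\<close>

lemma index_admissible_Un: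
  assumes A: "index_admissible X f A" and B: "index_admissible X f B"
  shows "index_admissible X f (A \<union> B)"
proof -
  have "top_of_set X interior_of A \<union> top_of_set X interior_of B \<subseteq> top_of_set X interior_of (A \<union> B)"
    by (simp add: interior_of_mono)
  then show ?thesis
    using assms by (auto simp: index_admissible_def)
qed

text \<open>The entries of the list are the pairs \<open>(d\<^sub>j, U\<^sub>j)\<close> of \<^const>\<open>index_integral\<close>.\<close>

definition index_representation ::
    "'a::euclidean_space set \<Rightarrow> ('a \<Rightarrow> 'a) \<Rightarrow> ('a \<Rightarrow> int) \<Rightarrow> (int \<times> 'a set) list \<Rightarrow> bool" where
  "index_representation X f k xs \<longleftrightarrow>
     (\<forall>(e, A) \<in> set xs. index_admissible X f A) \<and> (\<forall>x\<in>X. k x = (\<Sum>(e, A)\<leftarrow>xs. e * indicator A x))"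

definition index_value ::
    "'a::euclidean_space set \<Rightarrow> ('a \<Rightarrow> 'a) \<Rightarrow> (int \<times> 'a set) list \<Rightarrow> int" where
  "index_value X f xs = (\<Sum>(e, A)\<leftarrow>xs. e * combinatorial_index X f A)"

text \<open>Lists make representations combine by concatenation and allow induction over the
  terms.\<close>

lemma index_integral_list:
  "index_integral X f k = (THE v. \<exists>xs. index_representation X f k xs \<and> v = index_value X f xs)"
proof -
  have "(\<exists>(m::nat) (d::nat \<Rightarrow> int) U.
       (\<forall>j<m. index_admissible X f (U j)) \<and>
       (\<forall>x\<in>X. k x = (\<Sum>j<m. d j * indicator (U j) x)) \<and>
       v = (\<Sum>j<m. d j * combinatorial_index X f (U j)))
    \<longleftrightarrow> (\<exists>xs. index_representation X f k xs \<and> v = index_value X f xs)" (is "?L \<longleftrightarrow> ?R") for v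
  proof
    assume ?L
    then obtain m :: nat and d :: "nat \<Rightarrow> int" and U where
      "\<forall>j<m. index_admissible X f (U j)" "\<forall>x\<in>X. k x = (\<Sum>j<m. d j * indicator (U j) x)"
      "v = (\<Sum>j<m. d j * combinatorial_index X f (U j))"
      by blast
    moreover have "(\<Sum>(e, A)\<leftarrow>map (\<lambda>j. (d j, U j)) [0..<m]. F e A) = (\<Sum>j<m. F (d j) (U j))" for F :: "int \<Rightarrow> 'a set \<Rightarrow> int"
      by (simp add: comp_def interv_sum_list_conv_sum_set_nat atLeast0LessThan)
    ultimately show ?R
      unfolding index_representation_def index_value_def
      by (intro exI [of _ "map (\<lambda>j. (d j, U j)) [0..<m]"]) simp
  next
    assume ?R
    then obtain xs where "index_representation X f k xs" "v = index_value X f xs"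
      by blast
    moreover have "(\<Sum>(e, A)\<leftarrow>xs. F e A) = (\<Sum>j<length xs. F (fst (xs ! j)) (snd (xs ! j)))" for F :: "int \<Rightarrow> 'a set \<Rightarrow> int"
      by (simp add: sum_list_sum_nth case_prod_unfold atLeast0LessThan)
    moreover have "index_admissible X f (snd (xs ! j))" if "j < length xs" for j
      using \<open>index_representation X f k xs\<close> nth_mem [OF that]
      by (auto simp: index_representation_def case_prod_unfold)
    ultimately show ?L
      unfolding index_representation_def index_value_def
      by (intro exI [of _ "length xs"] exI [of _ "\<lambda>j. fst (xs ! j)"] exI [of _ "\<lambda>j. snd (xs ! j)"]) simp
  qed
  then show ?thesis
    unfolding index_integral_def by (simp only:)
qed

section \<open>The index as an additive function on clopen sets of fixed points\<close>

locale ENR_self_map =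
  fixes X :: "'a::euclidean_space set" and f :: "'a \<Rightarrow> 'a"
  assumes compact_X: "compact X" and ENR_X: "ENR X"
    and cont_f: "continuous_on X f" and f_into: "f \<in> X \<rightarrow> X"
begin

definition Fix :: "'a set" where "Fix = {x \<in> X. f x = x}"

definition clopens :: "'a set set" where
  "clopens = {C. C \<subseteq> Fix \<and> closed C \<and> closed (Fix - C)}"

text \<open>\<open>X - (Fix - C)\<close> is the largest open subset of \<open>X\<close> that meets the fixed point set exactly in \<open>C\<close>.\<close>

definition index_at :: "'a set \<Rightarrow> int" where
  "index_at C = fixed_point_index X f (X - (Fix - C))"

lemma closed_Fix: "closed Fix"
  unfolding Fix_def using continuous_closed_preimage_constant [of X "\<lambda>x. f x - x" 0]
  by (simp add: continuous_on_diff cont_f compact_X compact_imp_closed)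

lemma compact_clopens:
  assumes "C \<in> clopens"
  shows "compact C"
proof -
  have "X \<inter> C = C" "closed C"
    using assms by (auto simp: clopens_def Fix_def)
  then show ?thesis
    using compact_Int_closed [OF compact_X, of C] by simp
qed

lemma openin_Diff_closed: "closed S \<Longrightarrow> openin (top_of_set X) (X - S)"
  using openin_open_Int [of "- S" X] by (simp add: Diff_eq open_Compl)

lemma index_additive:
  assumes U: "openin (top_of_set X) U" "openin (top_of_set X) U1" "openin (top_of_set X) U2"
    and "U1 \<subseteq> U" "U2 \<subseteq> U" "compact (U \<inter> Fix)" "U \<inter> Fix \<subseteq> U1 \<union> U2" "U1 \<inter> U2 \<inter> Fix = {}"
  shows "fixed_point_index X f U = fixed_point_index X f U1 + fixed_point_index X f U2"
proof (rule fixed_point_index_additive [OF ENR_X cont_f f_into])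
  have Fix: "U' \<inter> Fix = {x \<in> U'. f x = x}" if "openin (top_of_set X) U'" for U'
    using openin_imp_subset [OF that] by (auto simp: Fix_def)
  show "compact {x \<in> U. f x = x}" "{x \<in> U. f x = x} \<subseteq> U1 \<union> U2" "{x \<in> U1 \<inter> U2. f x = x} = {}"
    using assms Fix [OF U(1)] Fix [OF openin_Int [OF U(2,3)]] by auto
qed (use assms in auto)

text \<open>Each index is split into that of \<open>U \<inter> U'\<close>, which carries all the
  fixed points, and that of the empty set; the two sums are the same.\<close>

lemma index_excision:
  assumes U: "openin (top_of_set X) U" "openin (top_of_set X) U'" and "compact (U \<inter> Fix)" "U \<inter> Fix = U' \<inter> Fix"
  shows "fixed_point_index X f U = fixed_point_index X f U'"
proof -
  have "fixed_point_index X f V = fixed_point_index X f (U \<inter> U') + fixed_point_index X f {}"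
    if "V = U \<or> V = U'" for V
    using that assms by (intro index_additive openin_Int) auto
  then show ?thesis
    by metis
qed

text \<open>The open sets belonging to \<open>A\<close> and \<open>B\<close> overlap only outside
  \<open>Fix\<close>, which is what additivity of the index asks for.\<close>

lemma index_at_additive:
  assumes "A \<in> clopens" "B \<in> clopens" "A \<inter> B = {}"
  shows "index_at (A \<union> B) = index_at A + index_at B"
proof -
  have "openin (top_of_set X) (X - (Fix - A))" "openin (top_of_set X) (X - (Fix - B))"
    "openin (top_of_set X) (X - (Fix - (A \<union> B)))"
    using assms by (auto intro!: openin_Diff_closed simp: clopens_def Diff_Un closed_Int)
  moreover have "(X - (Fix - (A \<union> B))) \<inter> Fix = A \<union> B"
    using assms by (auto simp: clopens_def Fix_def)
  ultimately show ?thesis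
    unfolding index_at_def using assms compact_clopens
    by (intro index_additive) (auto simp: compact_Un)
qed

lemma clopens_closed:
  assumes "A \<in> clopens" "B \<in> clopens"
  shows "A \<inter> B \<in> clopens" "A - B \<in> clopens"
proof -
  have "A - B = A \<inter> (Fix - B)" "Fix - (A - B) = (Fix - A) \<union> (Fix \<inter> B)" "Fix - A \<inter> B = (Fix - A) \<union> (Fix - B)"
    using assms by (auto simp: clopens_def)
  then show "A \<inter> B \<in> clopens" "A - B \<in> clopens"
    using assms closed_Fix by (auto simp: clopens_def intro!: closed_Int closed_Un)
qed

lemma Fix_clopens: "Fix \<in> clopens"
  by (simp add: clopens_def closed_Fix)

text \<open>The closure of the largest open set may contain fixed points outside \<open>C\<close>,
  and index-strictness speaks only of open sets without fixed points on the boundary. Separating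
  \<open>C\<close> from the rest of \<open>Fix\<close> by disjoint open sets gives such a set, with
  the same index by excision.\<close>

lemma index_at_separated:
  assumes "C \<in> clopens"
  obtains U where "openin (top_of_set X) U" "\<forall>x \<in> top_of_set X closure_of U - U. f x \<noteq> x"
    "index_at C = fixed_point_index X f U"
proof -
  have C: "C \<subseteq> Fix" "closed C" "closed (Fix - C)"
    using assms by (auto simp: clopens_def)
  then obtain S T where ST: "open S" "open T" "C \<subseteq> S" "Fix - C \<subseteq> T" "S \<inter> T = {}"
    using separation_normal [of C "Fix - C"] by auto
  let ?U = "X \<inter> S"
  have CU: "?U \<inter> Fix = C" 
    using C(1) ST by (auto simp: Fix_def)
  have opn: "openin (top_of_set X) ?U"
    using ST(1) by (rule openin_open_Int)
  show thesis
  proof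
    \<comment> \<open>The open set \<open>T\<close> contains all other fixed points and is disjoint
      from \<open>?U\<close>, so it also misses the closure.\<close>
    have "closure ?U \<inter> T = {}"
      using ST open_Int_closure_eq_empty [of T ?U] by blast
    then have "top_of_set X closure_of ?U \<inter> T = {}"
      using closure_mono [of "X \<inter> ?U" ?U] by (auto simp: closure_of_subtopology)
    moreover have "top_of_set X closure_of ?U \<subseteq> X"
      using closure_of_subset_topspace [of "top_of_set X" ?U] by simp
    ultimately show "\<forall>x \<in> top_of_set X closure_of ?U - ?U. f x \<noteq> x"
      using ST(4) CU by (auto simp: Fix_def)
    show "index_at C = fixed_point_index X f ?U"
      unfolding index_at_def
    proof (rule index_excision)
      have "(X - (Fix - C)) \<inter> Fix = C"
        using C(1) by (auto simp: Fix_def)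
      then show "compact ((X - (Fix - C)) \<inter> Fix)" "(X - (Fix - C)) \<inter> Fix = ?U \<inter> Fix"
        using CU compact_clopens [OF assms] by auto
    qed (rule openin_Diff_closed [OF C(3)], rule opn)
  qed (rule opn)
qed

text \<open>Without fixed points on the boundary, \<open>A\<close>, its interior and its closure
  meet \<open>Fix\<close> in the same set; the interior makes it relatively open and the closure
  makes it closed.\<close>

lemma admissible_clopen:
  assumes "index_admissible X f A"
  shows "A \<inter> Fix \<in> clopens" "combinatorial_index X f A = index_at (A \<inter> Fix)"
proof -
  let ?I = "top_of_set X interior_of A" and ?C = "top_of_set X closure_of A"
  have sub: "?I \<subseteq> A" "A \<subseteq> ?C"
    using assms closure_of_subset [of A "top_of_set X"] interior_of_subset [of "top_of_set X" A]
    by (auto simp: index_admissible_def)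
  have "x \<in> ?I" if "x \<in> ?C" "x \<in> Fix" for x
    using assms that by (auto simp: index_admissible_def Fix_def)
  then have eq: "A \<inter> Fix = ?I \<inter> Fix" "A \<inter> Fix = ?C \<inter> Fix"
    using sub by auto
  have "closed ?C"
    using closedin_closure_of [of "top_of_set X" A] compact_X
    by (metis closedin_closed_trans compact_imp_closed)
  have "closed (X - ?I)"
    using closedin_diff [OF closedin_topspace openin_interior_of, of "top_of_set X" A] compact_X
    by (metis closedin_closed_trans compact_imp_closed topspace_euclidean_subtopology)
  moreover have "Fix - (A \<inter> Fix) = Fix \<inter> (X - ?I)"
    unfolding eq(1) by (auto simp: Fix_def)
  ultimately show clopen: "A \<inter> Fix \<in> clopens"
    using \<open>closed ?C\<close> closed_Fix eq(2) by (auto simp: clopens_def)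
  show "combinatorial_index X f A = index_at (A \<inter> Fix)"
    unfolding combinatorial_index_def index_at_def
  proof (rule index_excision)
    show "compact (?I \<inter> Fix)"
      using compact_clopens [OF clopen] eq(1) by simp
    show "?I \<inter> Fix = (X - (Fix - A \<inter> Fix)) \<inter> Fix"
      using eq(1) by (auto simp: Fix_def)
    show "openin (top_of_set X) (X - (Fix - A \<inter> Fix))"
      using clopen by (intro openin_Diff_closed) (auto simp: clopens_def)
  qed simp
qed

end

section \<open>Well-definedness and monotonicity of the integral for an index of constant
  sign\<close>

locale signed_index_map = ENR_self_map X f
  for X :: "'a::euclidean_space set" and f :: "'a \<Rightarrow> 'a" +
  fixes \<sigma> :: int
  assumes sigma_nonzero: "\<sigma> \<noteq> 0"
    and sigma_index_nonneg: "\<And>U. openin (top_of_set X) U \<Longrightarrow>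
      \<forall>x \<in> top_of_set X closure_of U - U. f x \<noteq> x \<Longrightarrow> 0 \<le> \<sigma> * fixed_point_index X f U"
begin

lemma sigma_index_at_nonneg: "C \<in> clopens \<Longrightarrow> 0 \<le> \<sigma> * index_at C"
  by (metis index_at_separated sigma_index_nonneg)

text \<open>The list \<open>zs\<close>, in which the coefficients of \<open>xs\<close> are negated,
  represents the nonnegative function \<open>l - k\<close>; the sign condition makes its value
  nonnegative after multiplication by \<open>\<sigma>\<close>.\<close>

lemma index_value_mono:
  assumes xs: "index_representation X f k xs" and ys: "index_representation X f l ys"
    and le: "\<And>x. x \<in> X \<Longrightarrow> k x \<le> l x"
  shows "\<sigma> * index_value X f xs \<le> \<sigma> * index_value X f ys"
proof -
  define zs where "zs = ys @ map (\<lambda>(e, A). (- e, A)) xs"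
  \<comment> \<open>The additive set function lives on clopen subsets of \<open>Fix\<close>, so each
    set is replaced by its trace there, which carries its whole index.\<close>
  define ws where "ws = map (\<lambda>(e, A). (e, A \<inter> Fix)) zs"
  have adm: "index_admissible X f A" if "(e, A) \<in> set zs" for e A
    using that xs ys by (auto simp: zs_def index_representation_def)
  have neg: "(\<Sum>(e, A)\<leftarrow>map (\<lambda>(e, A). (- e, A)) xs. e * g A) = - (\<Sum>(e, A)\<leftarrow>xs. e * g A)" for g :: "'a set \<Rightarrow> int"
    by (induction xs) auto
  have val: "(\<Sum>(e, A)\<leftarrow>zs. e * g A) = (\<Sum>(e, A)\<leftarrow>ys. e * g A) - (\<Sum>(e, A)\<leftarrow>xs. e * g A)" for g :: "'a set \<Rightarrow> int"
    by (simp add: zs_def neg del: map_map)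
  have scale: "(\<Sum>(e, A)\<leftarrow>us. e * (\<sigma> * combinatorial_index X f A)) = \<sigma> * index_value X f us" for us
    by (induction us) (auto simp: index_value_def algebra_simps)
  \<comment> \<open>Monotonicity is used with lower bound \<open>0\<close> on \<open>Fix\<close>,
    for the nonnegative set function \<open>\<sigma> * index_at C\<close>.\<close>
  have "0 * (\<sigma> * index_at Fix) \<le> (\<Sum>(e, C)\<leftarrow>ws. e * (\<sigma> * index_at (C \<inter> Fix)))"
  proof (rule sum_list_additive_mono [of clopens])
    show "C \<in> clopens" if "(e, C) \<in> set ws" for e C
      using that adm admissible_clopen(1) by (auto simp: ws_def)
    fix x assume x: "x \<in> Fix"
    then have "(\<Sum>(e, C)\<leftarrow>ws. e * indicator C x) = (\<Sum>(e, C)\<leftarrow>zs. e * indicator C x :: int)"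
      by (auto simp: ws_def indicator_def intro!: arg_cong [where f = sum_list] map_cong)
    also have "\<dots> = l x - k x"
      using x xs ys by (simp add: val index_representation_def Fix_def)
    finally show "0 \<le> (\<Sum>(e, C)\<leftarrow>ws. e * indicator C x :: int)"
      using le x by (simp add: Fix_def)
  qed (use sigma_index_at_nonneg index_at_additive clopens_closed Fix_clopens in \<open>auto simp: distrib_left\<close>)
  also have "\<dots> = (\<Sum>(e, A)\<leftarrow>zs. e * (\<sigma> * combinatorial_index X f A))"
    using adm admissible_clopen(2)
    by (auto simp: ws_def Int_assoc intro!: arg_cong [where f = sum_list] map_cong)
  also have "\<dots> = \<sigma> * index_value X f ys - \<sigma> * index_value X f xs"
    unfolding scale by (simp add: index_value_def val right_diff_distrib)
  finally show ?thesis
    by simp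
qed

text \<open>The values of two representations of one function bound each other by monotonicity, and
  the nonzero factor \<open>\<sigma>\<close> cancels.\<close>

lemma index_integral_eq:
  assumes "index_representation X f k xs"
  shows "index_integral X f k = index_value X f xs"
  unfolding index_integral_list
proof (rule the_equality)
  show "\<exists>ys. index_representation X f k ys \<and> index_value X f xs = index_value X f ys"
    using assms by blast
  show "v = index_value X f xs" if "\<exists>ys. index_representation X f k ys \<and> v = index_value X f ys" for v
    using that index_value_mono [OF assms] index_value_mono [OF _ assms] sigma_nonzero
    by (metis mult_cancel_left order_antisym order_refl)
qed

section \<open>Integrable functions and limits of dyadic integrals\<close>

definition integrable :: "('a \<Rightarrow> int) \<Rightarrow> bool" where
  "integrable k \<longleftrightarrow> (\<exists>xs. index_representation X f k xs)"

lemma index_integral_mono: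
  "\<lbrakk>integrable k; integrable l; \<And>x. x \<in> X \<Longrightarrow> k x \<le> l x\<rbrakk>
    \<Longrightarrow> \<sigma> * index_integral X f k \<le> \<sigma> * index_integral X f l"
  unfolding integrable_def using index_integral_eq index_value_mono by (metis (no_types, lifting))

lemma index_integral_cmult:
  assumes "integrable k"
  shows "integrable (\<lambda>x. c * k x)" "index_integral X f (\<lambda>x. c * k x) = c * index_integral X f k"
proof -
  obtain xs where xs: "index_representation X f k xs"
    using assms integrable_def by blast
  let ?ys = "map (\<lambda>(e, A). (c * e, A)) xs"
  have sum: "(\<Sum>(e, A)\<leftarrow>?ys. e * g A) = c * (\<Sum>(e, A)\<leftarrow>xs. e * g A)" for g :: "'a set \<Rightarrow> int"
    by (induction xs) (auto simp: algebra_simps)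
  have ys: "index_representation X f (\<lambda>x. c * k x) ?ys"
    using xs unfolding index_representation_def sum by auto
  then show "integrable (\<lambda>x. c * k x)"
    unfolding integrable_def by blast
  show "index_integral X f (\<lambda>x. c * k x) = c * index_integral X f k"
    unfolding index_integral_eq [OF ys] index_integral_eq [OF xs] index_value_def sum ..
qed

lemma index_integral_const:
  "integrable (\<lambda>_. c)" "index_integral X f (\<lambda>_. c) = c * combinatorial_index X f X"
proof -
  have "index_admissible X f X"
    using closure_of_subset_topspace [of "top_of_set X" X] interior_of_topspace [of "top_of_set X"]
    by (auto simp: index_admissible_def)
  then have rep: "index_representation X f (\<lambda>_. c) [(c, X)]"
    by (simp add: index_representation_def)
  then show "integrable (\<lambda>_. c)"
    unfolding integrable_def by blast
  show "index_integral X f (\<lambda>_. c) = c * combinatorial_index X f X"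
    using index_integral_eq [OF rep] by (simp add: index_value_def)
qed

lemma integrable_finite_range:
  assumes "finite (k ` X)" and fibre: "\<And>c. index_admissible X f {x \<in> X. k x = c}"
  shows "integrable k"
proof -
  obtain cs where cs: "set cs = k ` X" "distinct cs"
    using finite_distinct_list [OF assms(1)] by blast
  let ?xs = "map (\<lambda>c. (c, {x \<in> X. k x = c})) cs"
  have "k x = (\<Sum>(e, A)\<leftarrow>?xs. e * indicator A x)" if "x \<in> X" for x
  proof -
    have "(\<Sum>(e, A)\<leftarrow>?xs. e * indicator A x) = (\<Sum>c\<in>k ` X. c * indicator {x \<in> X. k x = c} x)"
      using cs by (simp add: comp_def sum_list_distinct_conv_sum_set)
    also have "\<dots> = (\<Sum>c\<in>k ` X. if k x = c then c else 0)"
      using that by (intro sum.cong) (auto simp: indicator_def)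
    also have "\<dots> = k x"
      using assms(1) that by (simp add: sum.delta)
    finally show ?thesis ..
  qed
  then have "index_representation X f k ?xs"
    using fibre by (auto simp: index_representation_def)
  then show ?thesis
    unfolding integrable_def by blast
qed

text \<open>Doubling makes the scaled integrals monotone and the bound compares them with the
  integral of a constant; both come from monotonicity of the integral.\<close>

lemma convergent_dyadic_integrals:
  fixes k :: "nat \<Rightarrow> 'a \<Rightarrow> int"
  assumes int: "\<And>n. integrable (k n)"
    and double: "\<And>n x. x \<in> X \<Longrightarrow> 2 * k n x \<le> k (Suc n) x"
    and bound: "\<And>n x. x \<in> X \<Longrightarrow> k n x \<le> 2 ^ n * N"
  shows "convergent (\<lambda>n. 1 / 2 ^ n * real_of_int (index_integral X f (k n)))"
proof -
  \<comment> \<open>The factor \<open>\<sigma>\<close> makes the sequence increasing whichever sign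
    the index has; it is divided out at the end.\<close>
  define s where "s n = 1 / 2 ^ n * real_of_int (\<sigma> * index_integral X f (k n))" for n
  have "s n \<le> s (Suc n)" for n
  proof -
    have "\<sigma> * (2 * index_integral X f (k n)) \<le> \<sigma> * index_integral X f (k (Suc n))"
      using index_integral_mono [OF index_integral_cmult(1) int] int double
      by (simp flip: index_integral_cmult(2))
    then have "2 * real_of_int (\<sigma> * index_integral X f (k n)) \<le> real_of_int (\<sigma> * index_integral X f (k (Suc n)))"
      by linarith
    then show ?thesis
      by (simp add: s_def field_simps)
  qed
  then have "incseq s"
    by (rule incseq_SucI)
  moreover have "s n \<le> real_of_int (\<sigma> * (N * combinatorial_index X f X))" for n
  proof -
    \<comment> \<open>The integral of the constant \<open>2 ^ n * N\<close> loses its dependence on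
      \<open>n\<close> after division by \<open>2 ^ n\<close>.\<close>
    have "\<sigma> * index_integral X f (k n) \<le> \<sigma> * (2 ^ n * N * combinatorial_index X f X)"
      using index_integral_mono [OF int index_integral_const(1)] bound
      by (simp flip: index_integral_const(2))
    then have "real_of_int (\<sigma> * index_integral X f (k n)) \<le> real_of_int (\<sigma> * (2 ^ n * N * combinatorial_index X f X))"
      by (simp only: of_int_le_iff)
    then show ?thesis
      by (simp add: s_def field_simps)
  qed
  ultimately have "convergent s"
    by (metis incseq_convergent convergent_def)
  then have "convergent (\<lambda>n. inverse (real_of_int \<sigma>) * s n)"
    by (intro convergent_mult convergent_const)
  moreover have "inverse (real_of_int \<sigma>) * s n = 1 / 2 ^ n * real_of_int (index_integral X f (k n))" for n
    using sigma_nonzero by (simp add: s_def)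
  ultimately show ?thesis
    by simp
qed

end

text \<open>A fibre of the scaled floor or ceiling is the preimage of a half-open dyadic interval.
  It splits into the fibre over the included endpoint and the preimage of the open interval, covered
  by the first and second condition of \<open>real_integrable\<close>.\<close>

lemma index_admissible_dyadic:
  assumes h: "real_integrable X f h"
  shows "index_admissible X f {x \<in> X. \<lfloor>2 ^ n * h x\<rfloor> = j}" "index_admissible X f {x \<in> X. \<lceil>2 ^ n * h x\<rceil> = j}"
proof -
  define p where "p i = real_of_int i / 2 ^ n" for i
  have rat: "p i \<in> \<rat>" for i
    by (simp add: p_def)
  have less: "p i < p (i + 1)" for i
    by (simp add: p_def field_simps)
  have point: "index_admissible X f {x \<in> X. h x = p i}" for i
    using h rat by (auto simp: real_integrable_def index_admissible_def)
  have gap: "index_admissible X f {x \<in> X. p i < h x \<and> h x < p (i + 1)}" for i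
  proof -
    have "\<forall>x \<in> top_of_set X closure_of {x \<in> X. p i < h x \<and> h x < p (i + 1)}
        - top_of_set X interior_of {x \<in> X. p i < h x \<and> h x < p (i + 1)}. f x \<noteq> x"
      using h rat [of i] rat [of "i + 1"] less [of i] unfolding real_integrable_def by blast
    then show ?thesis
      by (auto simp: index_admissible_def)
  qed
  have "{x \<in> X. \<lfloor>2 ^ n * h x\<rfloor> = j} = {x \<in> X. h x = p j} \<union> {x \<in> X. p j < h x \<and> h x < p (j + 1)}"
    by (auto simp: p_def floor_eq_iff field_simps)
  then show "index_admissible X f {x \<in> X. \<lfloor>2 ^ n * h x\<rfloor> = j}"
    using index_admissible_Un [OF point gap] by simp
  \<comment> \<open>The ceiling includes the right endpoint, so the open interval starts at
    \<open>p (j - 1)\<close>; writing \<open>j - 1 + 1\<close> keeps the form of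
    \<open>gap\<close>.\<close>
  have "{x \<in> X. \<lceil>2 ^ n * h x\<rceil> = j} = {x \<in> X. h x = p j} \<union> {x \<in> X. p (j - 1) < h x \<and> h x < p (j - 1 + 1)}"
    by (auto simp: p_def ceiling_eq_iff field_simps)
  then show "index_admissible X f {x \<in> X. \<lceil>2 ^ n * h x\<rceil> = j}"
    using index_admissible_Un [OF point gap, of j "j - 1"] by simp
qed

theorem theorem4p6:
  fixes \<K> :: "'a::euclidean_space set set"
    and X :: "'a set" and f :: "'a \<Rightarrow> 'a" and h :: "'a \<Rightarrow> real"
  assumes "simplicial_complex \<K>" and "X = \<Union>\<K>"
    and "index_strict X f"
    and "real_integrable X f h"
  shows "convergent (\<lambda>n::nat. 1 / 2 ^ n * real_of_int (index_integral X f (\<lambda>x. \<lfloor>2 ^ n * h x\<rfloor>)))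
       \<and> convergent (\<lambda>n::nat. 1 / 2 ^ n * real_of_int (index_integral X f (\<lambda>x. \<lceil>2 ^ n * h x\<rceil>)))"
proof -
  \<comment> \<open>\<open>\<sigma>\<close> is 1 or -1 according to which case of index-strictness
    holds, so that both cases share one proof.\<close>
  obtain \<sigma> :: int where \<sigma>: "\<sigma> \<noteq> 0" "\<And>U. openin (top_of_set X) U \<Longrightarrow>
      \<forall>x \<in> top_of_set X closure_of U - U. f x \<noteq> x \<Longrightarrow> 0 \<le> \<sigma> * fixed_point_index X f U"
  proof -
    from assms(3) consider
      "\<And>U. openin (top_of_set X) U \<Longrightarrow> \<forall>x \<in> top_of_set X closure_of U - U. f x \<noteq> x \<Longrightarrow> fixed_point_index X f U \<ge> 0"
    | "\<And>U. openin (top_of_set X) U \<Longrightarrow> \<forall>x \<in> top_of_set X closure_of U - U. f x \<noteq> x \<Longrightarrow> fixed_point_index X f U \<le> 0"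
      unfolding index_strict_def by blast
    then show thesis
    proof cases
      case 1 then show thesis by (intro that [of 1]) auto
    next
      case 2 then show thesis by (intro that [of "-1"]) auto
    qed
  qed
  interpret signed_index_map X f \<sigma>
    using assms(3) \<sigma> polyhedron_compact_ENR [OF assms(1)]
    by unfold_locales (auto simp: assms(2) index_strict_def)
  have "\<exists>B. \<forall>x\<in>X. \<bar>h x\<bar> \<le> B"
    using assms(4) by (simp add: real_integrable_def bounded_iff)
  then obtain B where B: "\<And>x. x \<in> X \<Longrightarrow> \<bar>h x\<bar> \<le> B"
    by blast
  \<comment> \<open>Rounding up makes \<open>2 ^ n * N\<close> an integer, so the bound survives
    taking floors and ceilings of \<open>2 ^ n * h x\<close>.\<close>
  define N where "N = \<lceil>B\<rceil>"
  have N: "- real_of_int (2 ^ n * N) \<le> 2 ^ n * h x" "2 ^ n * h x \<le> real_of_int (2 ^ n * N)" if "x \<in> X" for n x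
  proof -
    have "\<bar>h x\<bar> \<le> real_of_int N"
      using B [OF that] unfolding N_def by linarith
    then have "\<bar>2 ^ n * h x\<bar> \<le> real_of_int (2 ^ n * N)"
      by (simp add: abs_mult)
    then show "- real_of_int (2 ^ n * N) \<le> 2 ^ n * h x" "2 ^ n * h x \<le> real_of_int (2 ^ n * N)"
      by linarith+
  qed
  have range: "\<lfloor>y\<rfloor> \<in> {- M..M}" "\<lceil>y\<rceil> \<in> {- M..M}"
    if "- real_of_int M \<le> y" "y \<le> real_of_int M" for M y
    using that unfolding atLeastAtMost_iff by linarith+
  have int_floor: "integrable (\<lambda>x. \<lfloor>2 ^ n * h x\<rfloor>)" for n
  proof (rule integrable_finite_range)
    have "(\<lambda>x. \<lfloor>2 ^ n * h x\<rfloor>) ` X \<subseteq> {- (2 ^ n * N)..2 ^ n * N}"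
      using range [OF N] by blast
    then show "finite ((\<lambda>x. \<lfloor>2 ^ n * h x\<rfloor>) ` X)"
      by (rule finite_subset) simp
  qed (rule index_admissible_dyadic [OF assms(4)])
  have int_ceiling: "integrable (\<lambda>x. \<lceil>2 ^ n * h x\<rceil>)" for n
  proof (rule integrable_finite_range)
    have "(\<lambda>x. \<lceil>2 ^ n * h x\<rceil>) ` X \<subseteq> {- (2 ^ n * N)..2 ^ n * N}"
      using range [OF N] by blast
    then show "finite ((\<lambda>x. \<lceil>2 ^ n * h x\<rceil>) ` X)"
      by (rule finite_subset) simp
  qed (rule index_admissible_dyadic [OF assms(4)])
  have "convergent (\<lambda>n::nat. 1 / 2 ^ n * real_of_int (index_integral X f (\<lambda>x. \<lfloor>2 ^ n * h x\<rfloor>)))"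
  proof (rule convergent_dyadic_integrals [OF int_floor])
    show "2 * \<lfloor>2 ^ n * h x\<rfloor> \<le> \<lfloor>2 ^ Suc n * h x\<rfloor>" for n x
      by (simp add: le_floor_iff)
    show "\<lfloor>2 ^ n * h x\<rfloor> \<le> 2 ^ n * N" if "x \<in> X" for n x
      using N(2) [OF that, of n] by linarith
  qed
  \<comment> \<open>Ceilings satisfy the doubling inequality in reverse, so their negatives are
    used; the upper bound for these comes from the lower bound on \<open>h\<close>. The product with
    \<open>- 1\<close> matches \<open>index_integral_cmult\<close>.\<close>
  moreover have "convergent (\<lambda>n::nat. 1 / 2 ^ n * real_of_int (index_integral X f (\<lambda>x. - 1 * \<lceil>2 ^ n * h x\<rceil>)))"
  proof (rule convergent_dyadic_integrals [OF index_integral_cmult(1) [OF int_ceiling]])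
    show "2 * (- 1 * \<lceil>2 ^ n * h x\<rceil>) \<le> - 1 * \<lceil>2 ^ Suc n * h x\<rceil>" for n x
      by (simp add: ceiling_le_iff)
    show "- 1 * \<lceil>2 ^ n * h x\<rceil> \<le> 2 ^ n * N" if "x \<in> X" for n x
      using N(1) [OF that, of n] by linarith
  qed
  then have "convergent (\<lambda>n::nat. - (1 / 2 ^ n * real_of_int (index_integral X f (\<lambda>x. \<lceil>2 ^ n * h x\<rceil>))))"
    unfolding index_integral_cmult(2) [OF int_ceiling, of "- 1"] by simp
  then have "convergent (\<lambda>n::nat. 1 / 2 ^ n * real_of_int (index_integral X f (\<lambda>x. \<lceil>2 ^ n * h x\<rceil>)))"
    using convergent_minus_iff by blast
  ultimately show ?thesis ..
qed

end
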